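(* For each of the following ten exponent tuples $(a_1,\dots,a_5)$ with associated pair $(r,a)$: \begin{itemize} \item $(4,4,6,6,6)$ with $(r,a)=(1,1)$; \item $(4,4,4,8,8)$ with $(r,a)=(2,2)$; \item $(3,4,4,7,42)$ with $(r,a)=(10,0)$; \item $(3,4,4,10,15)$ with $(r,a)=(10,4)$; \item $(4,4,4,5,20)$ with $(r,a)=(6,4)$; \item $(4,4,4,6,12)$ with $(r,a)=(4,4)$; \item $(3,4,4,8,24)$ with $(r,a)=(6,2)$; \item $(3,4,4,12,12)$ with $(r,a)=(2,0)$; \item $(4,4,5,5,10)$ with $(r,a)=(6,4)$; \item $(3,4,4,9,18)$ with $(r,a)=(6,2)$, \end{itemize} there exists a subgroup $G$ with $G_0\subset G\subset G^{\max}$ and $G\cong G_0\times \mathbb Z/2\mathbb Z$ such that Roan's Hodge numbers of $\widetilde{W/G}$, where $W=\sum_{i=1}^5 x_i^{a_i}$, are $$h^{1,1}(\widetilde{W/G})=5+3r-2a,\qquad h^{2,1}(\widetilde{W/G})=65-3r-2a,$$ i.e. they coincide with the Hodge numbers of the Borcea--Voisin Calabi--Yau threefold built from the corresponding K3 surface (with Nikulin invariants $(r,a)$) and an elliptic curve.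
   Context: Fix positive integers $a_1\le\dots\le a_5$ with $\sum_i 1/a_i=1$. Groups. $G^{\max}$ is the finite abelian group of diagonal symmetries of $W=\sum x_i^{a_i}$ of determinant $1$. Elements are written in fractional coordinates: $G^{\max}$ is identified with the set of vectors $g=(g_1,\dots,g_5)$ with $g_i\in\{0,\frac1{a_i},\dots,\frac{a_i-1}{a_i}\}$ and $\sum_i g_i\in\mathbb Z$, with coordinatewise addition modulo $1$; $g$ corresponds to the diagonal matrix with entries $\exp(2\pi\sqrt{-1}\,g_i)$. $G_0\subset G^{\max}$ is the cyclic subgroup generated by $(\frac1{a_1},\dots,\frac1{a_5})$ (its order is $d=\mathrm{lcm}(a_1,\dots,a_5)$). Mirror dual group. For $G_0\subset G\subset G^{\max}$, $G^T=\{g'\in G^{\max}: \sum_i g_i a_i g'_i\in\mathbb Z \text{ for all } g\in G\}$. Level. An element $g$ (with coordinates in $[0,1)$) has level $k$ if $\sum_i g_i=k$ (sum in $\mathbb Q$). Invariant deformations. $S^G$ is the set of $S\in\mathbb Z^5$ with $0\le S_i\le a_i-2$ for all $i$, $\sum_i \frac{S_i}{a_i}=1$, and $(\frac{S_1}{a_1},\dots,\frac{S_5}{a_5})\in G^T$. $S^{G^T}$ is the analogous set with the condition $(\frac{S_1}{a_1},\dots,\frac{S_5}{a_5})\in G$. Roan pairs. For a subgroup $H$ of $G^{\max}$, $H_{2Z}$ (resp. $H_{3Z}$) is the set of level one elements of $H$ having exactly two (resp. exactly three) zero coordinates. A $(G^T,G)$-Roan pair is a pair $(\mathbf z',\mathbf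 z)\in G^T_{2Z}\times G_{3Z}$ with $\sum_i z'_i a_i z_i=0$. A $(G,G^T)$-Roan pair is a pair $(\mathbf z,\mathbf z')\in G_{2Z}\times G^T_{3Z}$ with $\sum_i z_i a_i z'_i=0$. Roan's Hodge numbers. $$h^{2,1}(\widetilde{W/G})=|S^G|+|\{(G^T,G)\text{-Roan pairs}\}|,\qquad h^{1,1}(\widetilde{W/G})=|S^{G^T}|+|\{(G,G^T)\text{-Roan pairs}\}|.$$ Borcea--Voisin Hodge numbers. For a K3 surface $S$ with an involution acting by $-1$ on $H^{2,0}(S)$ with Nikulin invariants $(r,a,\delta)$ and an elliptic curve $E$ with involution, the resolved quotient of $S\times E$ by the product involution is (by a known result of Borcea) a Calabi--Yau threefold with $h^{1,1}=5+3r-2a$ and $h^{2,1}=65-3r-2a$; for the purposes of the statement only these numerical values matter. *)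

theory Defs
  imports Complex_Main "HOL-Algebra.Elementary_Groups"
begin

text \<open>
  The exponents are a list \<open>a\<close> of five positive natural numbers. A diagonal matrix with
  entries \<open>exp (2 \<pi> \<i> g\<^sub>i)\<close> is represented by the list of its fractional coordinates
  \<open>g\<^sub>i \<in> [0,1)\<close>; its determinant is \<open>1\<close> if and only if their sum is an integer.
  Positions are counted from 0.
\<close>

definition Gmax :: "nat list \<Rightarrow> rat list monoid" where
  "Gmax a =
     \<lparr>carrier = {g. length g = 5
                  \<and> (\<forall>i<5. \<exists>k<a ! i. g ! i = of_nat k / of_nat (a ! i))
                  \<and> (\<Sum>i<5. g ! i) \<in> \<int>},
      mult = map2 (\<lambda>x y. frac (x + y)),
      one = replicate 5 0\<rparr>"

definition G0 :: "nat list \<Rightarrow> rat list set" where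
  "G0 a = generate (Gmax a) {map (\<lambda>n. 1 / of_nat n) a}"

definition mirror_dual :: "nat list \<Rightarrow> rat list set \<Rightarrow> rat list set" where
  "mirror_dual a G =
     {g' \<in> carrier (Gmax a). \<forall>g\<in>G. (\<Sum>i<5. g ! i * of_nat (a ! i) * g' ! i) \<in> \<int>}"

definition level_one :: "rat list \<Rightarrow> bool" where
  "level_one g \<longleftrightarrow> (\<Sum>i<5. g ! i) = 1"

text \<open>
  The group \<open>H\<close> is the one that contains the vectors \<open>S\<^sub>i / a\<^sub>i\<close>: the set \<open>S\<^sup>G\<close> of the invariant
  deformations for \<open>G\<close> is obtained for \<open>H\<close> the mirror dual of \<open>G\<close>, and its mirror counterpart
  for \<open>H = G\<close>.
\<close>

definition deformations :: "nat list \<Rightarrow> rat list set \<Rightarrow> int list set" where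
  "deformations a H =
     {S. length S = 5
       \<and> (\<forall>i<5. 0 \<le> S ! i \<and> S ! i \<le> int (a ! i) - 2)
       \<and> (\<Sum>i<5. of_int (S ! i) / of_nat (a ! i) :: rat) = 1
       \<and> map2 (\<lambda>s n. of_int s / of_nat n) S a \<in> H}"

definition level_one_zeros :: "nat \<Rightarrow> rat list set \<Rightarrow> rat list set" where
  "level_one_zeros m H = {g \<in> H. level_one g \<and> card {i. i < 5 \<and> g ! i = 0} = m}"

text \<open>The \<open>(H, K)\<close>-Roan pairs; the component with two zeros lies in \<open>H\<close>.\<close>

definition roan_pairs ::
  "nat list \<Rightarrow> rat list set \<Rightarrow> rat list set \<Rightarrow> (rat list \<times> rat list) set" where
  "roan_pairs a H K =
     {(y, z). y \<in> level_one_zeros 2 H \<and> z \<in> level_one_zeros 3 K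
            \<and> (\<Sum>i<5. y ! i * of_nat (a ! i) * z ! i) = 0}"

definition roan_h21 :: "nat list \<Rightarrow> rat list set \<Rightarrow> nat" where
  "roan_h21 a G =
     card (deformations a (mirror_dual a G)) + card (roan_pairs a (mirror_dual a G) G)"

definition roan_h11 :: "nat list \<Rightarrow> rat list set \<Rightarrow> nat" where
  "roan_h11 a G = card (deformations a G) + card (roan_pairs a G (mirror_dual a G))"

end

(*
  Take G = G0 Un (G0 + h) for an element h of order two of Gmax outside G0. Elements of Gmax
  are given by their numerators k_i with k_i / a_i the coordinates, and with d = lcm(a_i) and
  w_i = d / a_i the sum of the coordinates is (sum_i k_i w_i) / d. An element lies in G^T if
  and only if it pairs integrally with h alone. The Hodge numbers involve only level one
  elements, that is numerators with sum_i k_i w_i = d, so both counts are finite enumerations.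
*)
theory Submission
  imports Defs "HOL-Library.Code_Binary_Nat"
begin

section \<open>Extending a subgroup by an involution\<close>

text \<open>The obstacle is that the groups consist of rational vectors and the mirror dual
  quantifies over a whole group, so nothing can be evaluated directly. Two descriptions of a point
  are kept apart. Arbitrary integer numerators serve for algebra: addition modulo 1 becomes plain
  addition, and integrality of a sum or of a pairing becomes divisibility by d, which survives
  reducing numerators mod a_i. Reduced numerators serve for counting: they are unique, and only for
  them does level one mean weighted sum exactly d, not just a multiple of d. The group is a direct
  product with Z/2, and not merely an extension, because h itself has order two: {0, h} is a
  complement of G0. Pairing with j/a_i yields j times the sum of the coordinates, which is already
  integral in Gmax; this is why G0 imposes no condition on the dual.\<close>

lemma (in comm_group) subgroup_Un_involution_coset:
  assumes H: "subgroup H G" and h: "h \<in> carrier G" "h \<otimes> h = \<one>"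
  shows "subgroup (H \<union> (H #> h)) G"
proof (rule subgroupI)
  have inv_h: "inv h = h"
    using h inv_equality by blast
  show "H \<union> (H #> h) \<subseteq> carrier G"
    using H h r_coset_subset_G subgroup.subset by blast
  show "H \<union> (H #> h) \<noteq> {}"
    using subgroup.one_closed[OF H] by blast
  show "inv x \<in> H \<union> (H #> h)" if "x \<in> H \<union> (H #> h)" for x
    using that
  proof
    assume "x \<in> H #> h"
    then obtain y where y: "y \<in> H" "x = y \<otimes> h"
      by (auto simp: r_coset_def)
    then have "inv x = inv y \<otimes> h"
      using H h inv_h by (simp add: inv_mult subgroup.mem_carrier)
    then show ?thesis
      using y H by (auto simp: r_coset_def subgroup.m_inv_closed)
  qed (use H in \<open>auto simp: subgroup.m_inv_closed\<close>)
  show "x \<otimes> y \<in> H \<union> (H #> h)" if xy: "x \<in> H \<union> (H #> h)" "y \<in> H \<union> (H #> h)" for x y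
  proof -
    \<comment> \<open>Commutativity moves every h to the right; two of them cancel, so the product
      of two coset elements falls back into H.\<close>
    have "u \<otimes> h \<otimes> v = u \<otimes> v \<otimes> h" "u \<otimes> h \<otimes> (v \<otimes> h) = u \<otimes> v" if "u \<in> H" "v \<in> H" for u v
    proof -
      have uv: "u \<in> carrier G" "v \<in> carrier G"
        using that H by (auto simp: subgroup.mem_carrier)
      then show "u \<otimes> h \<otimes> v = u \<otimes> v \<otimes> h"
        using h by (simp add: m_ac)
      have "u \<otimes> h \<otimes> (v \<otimes> h) = u \<otimes> v \<otimes> (h \<otimes> h)"
        using uv h(1) by (simp add: m_ac)
      then show "u \<otimes> h \<otimes> (v \<otimes> h) = u \<otimes> v"
        using uv h by simp
    qed
    moreover have "u \<otimes> (v \<otimes> h) = u \<otimes> v \<otimes> h" if "u \<in> H" "v \<in> H" for u v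
      using that H h by (simp add: m_assoc subgroup.mem_carrier)
    ultimately show ?thesis
      using xy subgroup.m_closed[OF H] by (auto simp: r_coset_def)
  qed
qed

text \<open>H and {1, h} form an internal direct product. The map sending (x, n) to x h^n is
  multiplicative because h h = 1, and injective because no x h with x in H lies in H. It starts from
  the product, where both components are given, and is inverted at the end.\<close>

lemma (in comm_group) subgroup_Un_involution_coset_iso:
  assumes H: "subgroup H G" and h: "h \<in> carrier G" "h \<otimes> h = \<one>" "h \<notin> H"
  shows "G\<lparr>carrier := H \<union> (H #> h)\<rparr> \<cong> G\<lparr>carrier := H\<rparr> \<times>\<times> integer_mod_group 2"
proof -
  let ?K = "G\<lparr>carrier := H \<union> (H #> h)\<rparr>" and ?P = "G\<lparr>carrier := H\<rparr> \<times>\<times> integer_mod_group 2"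
  define f where "f = (\<lambda>(x, n :: int). if n = 0 then x else x \<otimes> h)"
  have Hc: "x \<in> carrier G" if "x \<in> H" for x
    using that H by (simp add: subgroup.mem_carrier)
  have car: "carrier ?P = H \<times> {0, 1}"
    by (auto simp: DirProd_def carrier_integer_mod_group)
  have eq: "x \<otimes> h \<otimes> (y \<otimes> h) = x \<otimes> y" "x \<otimes> h \<otimes> y = x \<otimes> y \<otimes> h" "x \<otimes> (y \<otimes> h) = x \<otimes> y \<otimes> h"
    if "x \<in> H" "y \<in> H" for x y
  proof -
    have "x \<otimes> h \<otimes> (y \<otimes> h) = x \<otimes> y \<otimes> (h \<otimes> h)"
      using that Hc h(1) by (simp add: m_ac)
    then show "x \<otimes> h \<otimes> (y \<otimes> h) = x \<otimes> y"
      using that Hc h by simp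
    show "x \<otimes> h \<otimes> y = x \<otimes> y \<otimes> h" "x \<otimes> (y \<otimes> h) = x \<otimes> y \<otimes> h"
      using that Hc h by (simp_all add: m_ac)
  qed
  have notin: "x \<otimes> h \<notin> H" if "x \<in> H" for x
  proof
    assume "x \<otimes> h \<in> H"
    then have "inv x \<otimes> (x \<otimes> h) \<in> H"
      using that H by (simp add: subgroup.m_closed subgroup.m_inv_closed)
    then show False
      using that Hc h by (simp add: m_assoc[symmetric])
  qed
  have "f \<in> hom ?P ?K"
    unfolding hom_def car
    by (auto simp: f_def r_coset_def DirProd_def eq mult_integer_mod_group)
  moreover have "inj_on f (carrier ?P)"
    unfolding car inj_on_def using notin Hc h
    by (auto simp: f_def dest: Hc)
  moreover have "f ` carrier ?P = carrier ?K"
  proof -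
    have "f ` (H \<times> {0, 1}) = H \<union> (H #> h)"
      by (force simp: f_def r_coset_def image_iff)
    then show ?thesis
      unfolding car by simp
  qed
  ultimately have "f \<in> iso ?P ?K"
    by (simp add: iso_def bij_betw_def)
  moreover have "group ?P"
    by (intro DirProd_group subgroup_imp_group H group_integer_mod_group)
  ultimately show ?thesis
    using group.iso_sym is_isoI by blast
qed

section \<open>Numerator vectors\<close>

definition weighted_sum :: "nat list \<Rightarrow> nat list \<Rightarrow> nat" where
  "weighted_sum w k = sum_list (map2 (*) k w)"

text \<open>A depth-first search carrying the remaining weight s. The guard prunes the search and
  also keeps \<open>s - x * v\<close> free of truncated subtraction.\<close>

fun solutions :: "nat list \<Rightarrow> nat list \<Rightarrow> nat \<Rightarrow> nat list list" where
  "solutions (n # a) (v # w) s =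
     concat (map (\<lambda>x. if x * v \<le> s then map ((#) x) (solutions a w (s - x * v)) else []) [0..<n])"
| "solutions _ _ s = (if s = 0 then [[]] else [])"

lemma set_solutions:
  "length a = length w \<Longrightarrow>
    set (solutions a w s) = {k. list_all2 (<) k a \<and> weighted_sum w k = s}"
proof (induction a w arbitrary: s rule: list_induct2)
  case Nil
  then show ?case
    by (auto simp: weighted_sum_def)
next
  case (Cons n a v w)
  show ?case
  proof (rule Set.set_eqI)
    fix k
    have "k \<in> set (solutions (n # a) (v # w) s) \<longleftrightarrow>
        (\<exists>x<n. x * v \<le> s \<and> (\<exists>l. list_all2 (<) l a \<and> weighted_sum w l = s - x * v \<and> k = x # l))"
      by (auto simp: Cons.IH split: if_splits)
    also have "\<dots> \<longleftrightarrow> list_all2 (<) k (n # a) \<and> weighted_sum (v # w) k = s"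
      by (auto simp: weighted_sum_def list_all2_Cons2)
    finally show "k \<in> set (solutions (n # a) (v # w) s) \<longleftrightarrow>
        k \<in> {k. list_all2 (<) k (n # a) \<and> weighted_sum (v # w) k = s}"
      by simp
  qed
qed

text \<open>The bound S_i <= a_i - 2 is written additively, since on natural numbers the difference
  would truncate for a_i = 1.\<close>

definition deformation_numerators :: "nat list \<Rightarrow> nat list list \<Rightarrow> nat list list" where
  "deformation_numerators a L = filter (\<lambda>k. list_all2 (\<lambda>x n. x + 2 \<le> n) k a) L"

definition zeros_numerators :: "nat \<Rightarrow> nat list list \<Rightarrow> nat list list" where
  "zeros_numerators m L = filter (\<lambda>k. length (filter (\<lambda>x. x = 0) k) = m) L"

definition pair_numerators :: "nat list list \<Rightarrow> nat list list \<Rightarrow> (nat list \<times> nat list) list" where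
  "pair_numerators L M =
     filter (\<lambda>(y, z). list_all2 (\<lambda>u v. u = 0 \<or> v = 0) y z)
       (List.product (zeros_numerators 2 L) (zeros_numerators 3 M))"

text \<open>In both Hodge numbers the deformations and the pair component with two zeros come from
  the same group. One function thus serves for both, with the roles of G and its dual
  exchanged.\<close>

definition hodge_count :: "nat list \<Rightarrow> nat list list \<Rightarrow> nat list list \<Rightarrow> nat" where
  "hodge_count a L M =
     card (set (deformation_numerators a L)) + card (set (pair_numerators L M))"

text \<open>The j-th multiple of the generator has coordinates j / a_i modulo 1. Since d is a common
  multiple of the a_i, d values of j suffice; repetitions would be harmless, as counts are taken of
  sets.\<close>

definition diagonal_numerators :: "nat list \<Rightarrow> nat \<Rightarrow> nat list list" where
  "diagonal_numerators a d = map (\<lambda>j. map (\<lambda>n. j mod n) a) [0..<d]"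

definition shifted_numerators :: "nat list \<Rightarrow> nat list \<Rightarrow> nat \<Rightarrow> nat list list" where
  "shifted_numerators a h d = map (\<lambda>j. map2 (\<lambda>n x. (j + x) mod n) a h) [0..<d]"

definition level_one_extension :: "nat list \<Rightarrow> nat list \<Rightarrow> nat list \<Rightarrow> nat \<Rightarrow> nat list list" where
  "level_one_extension a w h d =
     filter (\<lambda>k. weighted_sum w k = d) (diagonal_numerators a d @ shifted_numerators a h d)"

text \<open>The pairing of h with k is the sum of the h_i k_i / a_i, that is, the weighted sum of
  the coordinatewise product divided by d. The dual is not given by generators, hence the search
  through all level one vectors.\<close>

definition level_one_dual :: "nat list \<Rightarrow> nat list \<Rightarrow> nat list \<Rightarrow> nat \<Rightarrow> nat list list" where
  "level_one_dual a w h d =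
     filter (\<lambda>k. d dvd weighted_sum w (map2 (*) h k)) (solutions a w d)"

text \<open>\<open>sum_list w = d\<close> encodes that the 1/a_i add up to 1, and
  \<open>n dvd 2 * x\<close> that doubling h gives 0. The zero vector is the diagonal entry j = 0,
  so the last clause also makes the order of h exactly two.\<close>

definition involution_numerators :: "nat list \<Rightarrow> nat list \<Rightarrow> nat list \<Rightarrow> nat \<Rightarrow> bool" where
  "involution_numerators a w h d \<longleftrightarrow>
     length a = 5 \<and> list_all (\<lambda>n. 1 < n) a \<and> length w = 5 \<and> 0 < d
     \<and> list_all2 (\<lambda>n v. n * v = d) a w \<and> sum_list w = d
     \<and> list_all2 (<) h a \<and> list_all2 (\<lambda>x n. n dvd 2 * x) h a \<and> d dvd weighted_sum w h
     \<and> h \<notin> set (diagonal_numerators a d)"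

text \<open>
  Here \<open>w\<close> is the list of the \<open>d / a\<^sub>i\<close>, \<open>h\<close> the numerators of the involution,
  and \<open>p\<close>, \<open>q\<close> are the values of \<open>h\<^sup>1\<^sup>,\<^sup>1\<close> and \<open>h\<^sup>2\<^sup>,\<^sup>1\<close>.
\<close>

definition hodge_check :: "nat list \<Rightarrow> nat list \<Rightarrow> nat list \<Rightarrow> nat \<Rightarrow> nat \<Rightarrow> nat \<Rightarrow> bool" where
  "hodge_check a w h d p q \<longleftrightarrow> involution_numerators a w h d
     \<and> (let L = level_one_extension a w h d; M = level_one_dual a w h d
        in hodge_count a L M = p \<and> hodge_count a M L = q)"


section \<open>Points with given numerators\<close>

locale fermat_exponents =
  fixes a w :: "nat list" and d :: nat
  assumes length_a: "length a = 5" and length_w: "length w = 5" and d_pos: "0 < d"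
    and a_w: "\<And>i. i < 5 \<Longrightarrow> a ! i * w ! i = d"
begin

text \<open>Numerators may be any integers, so that sums and negatives need no reduction;
  \<open>frac\<close> does it once.\<close>

definition point :: "(nat \<Rightarrow> int) \<Rightarrow> rat list" where
  "point f = map (\<lambda>i. frac (of_int (f i) / of_nat (a ! i))) [0..<5]"

text \<open>This is d times the sum of the f_i / a_i before fractional parts are taken. Changing f_i
  by a multiple of a_i changes it by a multiple of d, so its residue mod d depends on the point
  alone.\<close>

definition weight :: "(nat \<Rightarrow> int) \<Rightarrow> int" where
  "weight f = (\<Sum>i<5. f i * int (w ! i))"

definition numerators :: "nat list set" where
  "numerators = {k. list_all2 (<) k a}"

abbreviation point_of :: "nat list \<Rightarrow> rat list" where
  "point_of k \<equiv> point (\<lambda>i. int (k ! i))"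

lemma a_pos: "i < 5 \<Longrightarrow> 0 < a ! i"
  using a_w[of i] d_pos by (metis mult_eq_0_iff neq0_conv)

lemma length_point [simp]: "length (point f) = 5"
  by (simp add: point_def)

lemma point_nth [simp]: "i < 5 \<Longrightarrow> point f ! i = frac (of_int (f i) / of_nat (a ! i))"
  by (simp add: point_def)

lemma numeratorsD:
  assumes "k \<in> numerators"
  shows "length k = 5" "i < 5 \<Longrightarrow> k ! i < a ! i"
  using assms length_a by (auto simp: numerators_def list_all2_conv_all_nth)

lemma weighted_sum_eq: "length k = 5 \<Longrightarrow> int (weighted_sum w k) = weight (\<lambda>i. int (k ! i))"
  using length_w
  by (simp add: weighted_sum_def weight_def sum_list_sum_nth atLeast0LessThan)

lemma inverse_a: "i < 5 \<Longrightarrow> 1 / of_nat (a ! i) = (of_nat (w ! i) / of_nat d :: rat)"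
  using a_w[of i] a_pos[of i] d_pos by (simp add: field_simps flip: of_nat_mult)

lemma sum_quotients: "(\<Sum>i<5. of_int (f i) / of_nat (a ! i) :: rat) = of_int (weight f) / of_nat d"
proof -
  have "(\<Sum>i<5. of_int (f i) / of_nat (a ! i) :: rat)
      = (\<Sum>i<5. of_int (f i) * (of_nat (w ! i) / of_nat d))"
    by (rule sum.cong) (simp_all flip: inverse_a)
  also have "\<dots> = of_int (weight f) / of_nat d"
    by (simp add: weight_def sum_divide_distrib)
  finally show ?thesis .
qed

lemma of_int_divide_Ints: "(of_int n / of_nat d :: rat) \<in> \<int> \<longleftrightarrow> int d dvd n"
proof
  assume "(of_int n / of_nat d :: rat) \<in> \<int>"
  then obtain m where "(of_int n / of_nat d :: rat) = of_int m"
    by (auto elim: Ints_cases)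
  then have "(of_int n :: rat) = of_int (m * int d)"
    using d_pos by (simp add: field_simps)
  then show "int d dvd n"
    by (simp only: of_int_eq_iff) simp
next
  assume "int d dvd n"
  then obtain m where "n = int d * m" ..
  then show "(of_int n / of_nat d :: rat) \<in> \<int>"
    using d_pos by simp
qed

lemma sum_Ints_cong:
  fixes f g :: "nat \<Rightarrow> rat"
  assumes "\<And>i. i < 5 \<Longrightarrow> f i - g i \<in> \<int>"
  shows "(\<Sum>i<5. f i) \<in> \<int> \<longleftrightarrow> (\<Sum>i<5. g i) \<in> \<int>"
proof -
  have "(\<Sum>i<5. f i) - (\<Sum>i<5. g i) \<in> \<int>"
    unfolding sum_subtractf[symmetric] by (rule Ints_sum) (use assms in auto)
  then show ?thesis
    by (metis Ints_add Ints_diff add_diff_cancel_left' add_diff_eq diff_add_cancel)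
qed

lemma sum_point_Ints: "(\<Sum>i<5. point f ! i) \<in> \<int> \<longleftrightarrow> int d dvd weight f"
proof -
  have "(\<Sum>i<5. point f ! i) \<in> \<int> \<longleftrightarrow> (\<Sum>i<5. of_int (f i) / of_nat (a ! i) :: rat) \<in> \<int>"
    by (rule sum_Ints_cong) (simp add: frac_def)
  then show ?thesis
    by (simp add: sum_quotients of_int_divide_Ints)
qed

text \<open>Subtracting integers m and l from f_i / a_i and g_i / a_i changes the i-th term only by
  an integer, because the factor a_i clears the denominators of the cross terms.\<close>

lemma pairing_Ints:
  "(\<Sum>i<5. point f ! i * of_nat (a ! i) * point g ! i) \<in> \<int> \<longleftrightarrow> int d dvd weight (\<lambda>i. f i * g i)"
proof -
  have "(\<Sum>i<5. point f ! i * of_nat (a ! i) * point g ! i) \<in> \<int>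
      \<longleftrightarrow> (\<Sum>i<5. of_int (f i * g i) / of_nat (a ! i) :: rat) \<in> \<int>"
  proof (rule sum_Ints_cong)
    fix i :: nat
    assume i: "i < 5"
    define m l :: int where "m = \<lfloor>of_int (f i) / of_nat (a ! i) :: rat\<rfloor>"
      and "l = \<lfloor>of_int (g i) / of_nat (a ! i) :: rat\<rfloor>"
    have "point f ! i * of_nat (a ! i) * point g ! i - of_int (f i * g i) / of_nat (a ! i)
        = of_int (m * l * int (a ! i) - m * g i - l * f i)"
      using i a_pos[OF i] by (simp add: frac_def field_simps flip: m_def l_def)
    then show "point f ! i * of_nat (a ! i) * point g ! i - of_int (f i * g i) / of_nat (a ! i) \<in> \<int>"
      by simp
  qed
  then show ?thesis
    by (simp add: sum_quotients of_int_divide_Ints del: of_int_mult)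
qed

lemma point_eqI:
  assumes "\<And>i. i < 5 \<Longrightarrow> int (a ! i) dvd f i - g i"
  shows "point f = point g"
proof (rule nth_equalityI)
  fix i
  assume "i < length (point f)"
  then have i: "i < 5"
    by simp
  obtain m where "f i - g i = int (a ! i) * m"
    using assms[OF i] ..
  then have "(of_int (f i) / of_nat (a ! i) :: rat) = of_int (g i) / of_nat (a ! i) + of_int m"
    using a_pos[OF i] by (simp add: field_simps) 
  then show "point f ! i = point g ! i"
    using i by simp
qed simp

lemma point_of_nth:
  assumes "k \<in> numerators" "i < 5"
  shows "point_of k ! i = of_nat (k ! i) / of_nat (a ! i)"
  using assms numeratorsD(2)[OF assms] by (simp add: frac_eq)

text \<open>This turns cardinalities of sets of rational vectors into cardinalities of sets of
  numerator lists.\<close>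

lemma inj_on_point_of: "inj_on point_of numerators"
proof (rule inj_onI)
  fix k l
  assume kl: "k \<in> numerators" "l \<in> numerators" and eq: "point_of k = point_of l"
  show "k = l"
  proof (rule nth_equalityI)
    fix i
    assume "i < length k"
    then have i: "i < 5"
      using kl numeratorsD by auto
    have "(of_nat (k ! i) / of_nat (a ! i) :: rat) = of_nat (l ! i) / of_nat (a ! i)"
      using eq i kl by (metis point_of_nth)
    then show "k ! i = l ! i"
      using a_pos[OF i] by simp
  qed (use kl numeratorsD in auto)
qed

lemma point_reduce:
  defines "reduce f \<equiv> map (\<lambda>i. nat (f i mod int (a ! i))) [0..<5]"
  shows "reduce f \<in> numerators" "point_of (reduce f) = point f"
proof -
  show "reduce f \<in> numerators"
    using a_pos length_a
    by (auto simp: reduce_def numerators_def list_all2_conv_all_nth nat_less_iff)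
  show "point_of (reduce f) = point f"
    by (rule point_eqI)
      (use a_pos in \<open>auto simp: reduce_def mod_eq_dvd_iff[symmetric]\<close>)
qed

section \<open>The group of diagonal symmetries\<close>

lemma carrier_Gmax: "carrier (Gmax a) = {point f | f. int d dvd weight f}"
proof (intro equalityI subsetI)
  fix g
  assume "g \<in> carrier (Gmax a)"
  then have g: "length g = 5" "\<forall>i<5. \<exists>k<a ! i. g ! i = of_nat k / of_nat (a ! i)"
    "(\<Sum>i<5. g ! i) \<in> \<int>"
    by (auto simp: Gmax_def)
  then obtain k where k: "\<And>i. i < 5 \<Longrightarrow> k i < a ! i \<and> g ! i = of_nat (k i) / of_nat (a ! i)"
    by metis
  have "g = point (\<lambda>i. int (k i))"
  proof (rule nth_equalityI)
    fix i
    assume "i < length g"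
    then have "i < 5"
      using g(1) by simp
    then show "g ! i = point (\<lambda>i. int (k i)) ! i"
      using k[of i] by (simp add: frac_eq)
  qed (simp add: g(1))
  then show "g \<in> {point f | f. int d dvd weight f}"
    using g(3) sum_point_Ints by blast
next
  fix g
  assume "g \<in> {point f | f. int d dvd weight f}"
  then obtain f where f: "g = point f" "int d dvd weight f"
    by blast
  obtain k where k: "k \<in> numerators" "point f = point_of k"
    using point_reduce by metis
  show "g \<in> carrier (Gmax a)"
    unfolding Gmax_def using f sum_point_Ints[of f] k numeratorsD(2)[OF k(1)] point_of_nth[OF k(1)]
    by auto
qed

lemma carrier_GmaxE:
  assumes "g \<in> carrier (Gmax a)"
  obtains f where "g = point f" "int d dvd weight f"
  using assms by (auto simp: carrier_Gmax)

lemma point_mult: "point f \<otimes>\<^bsub>Gmax a\<^esub> point g = point (\<lambda>i. f i + g i)"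
proof -
  have frac_frac: "frac (frac x + frac y) = frac (x + y)" for x y :: rat
    by (metis add.commute frac_def frac_of_int frac_unique_iff add_diff_eq diff_add_eq frac_add_simps)
  show ?thesis
    by (rule nth_equalityI) (auto simp: Gmax_def frac_frac add_divide_distrib)
qed

lemma weight_add: "weight (\<lambda>i. f i + g i) = weight f + weight g"
  by (simp add: weight_def sum.distrib algebra_simps)

lemma weight_mult: "weight (\<lambda>i. c * f i) = c * weight f"
  by (simp add: weight_def sum_distrib_left algebra_simps)

lemma one_Gmax: "\<one>\<^bsub>Gmax a\<^esub> = point (\<lambda>i. 0)"
  by (simp add: Gmax_def point_def map_replicate_const)

lemma comm_group_Gmax: "comm_group (Gmax a)"
proof (rule comm_groupI)
  show "\<one>\<^bsub>Gmax a\<^esub> \<in> carrier (Gmax a)"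
    by (force simp: carrier_Gmax one_Gmax weight_def)
next
  fix x
  assume "x \<in> carrier (Gmax a)"
  then obtain f where f: "x = point f" "int d dvd weight f"
    by (rule carrier_GmaxE)
  then have "point (\<lambda>i. - f i) \<in> carrier (Gmax a)"
    using weight_mult[of "- 1" f] by (auto simp: carrier_Gmax)
  moreover have "point (\<lambda>i. - f i) \<otimes>\<^bsub>Gmax a\<^esub> x = \<one>\<^bsub>Gmax a\<^esub>"
    by (simp add: f point_mult one_Gmax)
  ultimately show "\<exists>y\<in>carrier (Gmax a). y \<otimes>\<^bsub>Gmax a\<^esub> x = \<one>\<^bsub>Gmax a\<^esub>" ..
next
  fix x y
  assume "x \<in> carrier (Gmax a)" "y \<in> carrier (Gmax a)"
  then show "x \<otimes>\<^bsub>Gmax a\<^esub> y \<in> carrier (Gmax a)"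
    by (elim carrier_GmaxE) (auto simp: carrier_Gmax point_mult weight_add)
qed (auto elim!: carrier_GmaxE simp: point_mult one_Gmax add_ac)

lemma inv_point:
  assumes "int d dvd weight f"
  shows "inv\<^bsub>Gmax a\<^esub> point f = point (\<lambda>i. - f i)"
proof -
  interpret comm_group "Gmax a"
    by (rule comm_group_Gmax)
  show ?thesis
    by (rule inv_equality)
      (use assms weight_mult[of "- 1" f] in \<open>auto simp: carrier_Gmax point_mult one_Gmax\<close>)
qed

end

section \<open>Counting level one elements\<close>

context fermat_exponents
begin

lemma level_one_point_of:
  assumes "k \<in> numerators"
  shows "level_one (point_of k) \<longleftrightarrow> weighted_sum w k = d"
proof -
  have "(\<Sum>i<5. point_of k ! i) = (\<Sum>i<5. of_int (int (k ! i)) / of_nat (a ! i))"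
    by (rule sum.cong) (use assms point_of_nth in auto)
  also have "\<dots> = of_nat (weighted_sum w k) / of_nat d"
    unfolding sum_quotients weighted_sum_eq[OF numeratorsD(1)[OF assms], symmetric] by simp
  finally show ?thesis
    using d_pos by (auto simp: level_one_def simp del: point_nth)
qed

lemma point_of_eq_0_iff:
  assumes "k \<in> numerators" "i < 5"
  shows "point_of k ! i = 0 \<longleftrightarrow> k ! i = 0"
  using assms a_pos[of i] by (simp add: point_of_nth del: point_nth)

text \<open>A deformation divided by the exponents has coordinate sum 1, so H is consulted only at
  level one, and L is assumed to list exactly those elements. The bound a_i - 2 makes the numerators
  reduced already.\<close>

lemma deformations_eq:
  assumes L: "set L \<subseteq> numerators" and H: "{g \<in> H. level_one g} = point_of ` set L"
  shows "deformations a H = map int ` set (deformation_numerators a L)"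
proof -
  have quot: "map2 (\<lambda>s n. of_int s / of_nat n) (map int k) a = point_of k" if "k \<in> numerators" for k
    using that numeratorsD(1)[OF that] length_a
    by (intro nth_equalityI) (auto simp: point_of_nth simp del: point_nth)
  have sum1: "(\<Sum>i<5. of_int (map int k ! i) / of_nat (a ! i) :: rat) = 1 \<longleftrightarrow> level_one (point_of k)"
    if "k \<in> numerators" for k
    unfolding level_one_def
    by (intro arg_cong[where f = "\<lambda>x. x = 1"] sum.cong)
      (use that numeratorsD(1)[OF that] point_of_nth[OF that] in \<open>auto simp del: point_nth\<close>)
  show ?thesis
  proof (intro equalityI subsetI)
    fix S
    assume S: "S \<in> deformations a H"
    define k where "k = map nat S"
    have len: "length S = 5" and bounds: "\<And>i. i < 5 \<Longrightarrow> 0 \<le> S ! i \<and> S ! i \<le> int (a ! i) - 2"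
      using S by (auto simp: deformations_def)
    have S_eq: "S = map int k"
      using len bounds by (intro nth_equalityI) (auto simp: k_def)
    have k: "k \<in> numerators"
      using len bounds length_a by (force simp: k_def numerators_def list_all2_conv_all_nth nat_less_iff)
    have "point_of k \<in> {g \<in> H. level_one g}"
      using S unfolding deformations_def S_eq by (simp only: mem_Collect_eq quot[OF k] sum1[OF k])
    then have "k \<in> set L"
      unfolding H using k L inj_on_point_of by (auto dest: inj_onD)
    moreover have "list_all2 (\<lambda>x n. x + 2 \<le> n) k a"
      using len bounds length_a by (force simp: k_def list_all2_conv_all_nth)
    ultimately show "S \<in> map int ` set (deformation_numerators a L)"
      using S_eq by (simp add: deformation_numerators_def)
  next
    fix S
    assume "S \<in> map int ` set (deformation_numerators a L)"
    then obtain k where k: "S = map int k" "k \<in> set L" "list_all2 (\<lambda>x n. x + 2 \<le> n) k a"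
      by (auto simp: deformation_numerators_def)
    have num: "k \<in> numerators"
      using k L by auto
    have "point_of k \<in> {g \<in> H. level_one g}"
      unfolding H using k(2) by blast
    moreover have "\<forall>i<5. 0 \<le> S ! i \<and> S ! i \<le> int (a ! i) - 2"
      using k length_a by (force simp: list_all2_conv_all_nth)
    ultimately show "S \<in> deformations a H"
      unfolding deformations_def k(1)
      by (simp only: mem_Collect_eq quot[OF num] sum1[OF num])
        (simp add: numeratorsD(1)[OF num])
  qed
qed

lemma level_one_zeros_eq:
  assumes L: "set L \<subseteq> numerators" and H: "{g \<in> H. level_one g} = point_of ` set L"
  shows "level_one_zeros m H = point_of ` set (zeros_numerators m L)"
proof -
  have "card {i. i < 5 \<and> point_of k ! i = 0} = length (filter (\<lambda>x. x = 0) k)"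
    if "k \<in> set L" for k
  proof -
    have k: "k \<in> numerators"
      using that L by blast
    then have "{i. i < 5 \<and> point_of k ! i = 0} = {i. i < length k \<and> k ! i = 0}"
      using point_of_eq_0_iff[OF k] numeratorsD(1)[OF k] by auto
    then show ?thesis
      by (simp add: length_filter_conv_card)
  qed
  moreover have "level_one_zeros m H
      = {g \<in> {g \<in> H. level_one g}. card {i. i < 5 \<and> g ! i = 0} = m}"
    by (auto simp: level_one_zeros_def)
  ultimately show ?thesis
    unfolding H zeros_numerators_def by auto
qed

text \<open>All summands are nonnegative and a_i is positive, so the pairing vanishes only when the
  supports are disjoint. Over the rationals this is vanishing, not integrality.\<close>

lemma pairing_eq_0_iff:
  assumes k: "k \<in> numerators" "l \<in> numerators"
  shows "(\<Sum>i<5. point_of k ! i * of_nat (a ! i) * point_of l ! i) = 0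
    \<longleftrightarrow> list_all2 (\<lambda>u v. u = 0 \<or> v = 0) k l"
proof -
  have "(\<Sum>i<5. point_of k ! i * of_nat (a ! i) * point_of l ! i) = 0
      \<longleftrightarrow> (\<forall>i\<in>{..<5}. point_of k ! i * of_nat (a ! i) * point_of l ! i = 0)"
    by (rule sum_nonneg_eq_0_iff) auto
  also have "\<dots> \<longleftrightarrow> (\<forall>i<5. k ! i = 0 \<or> l ! i = 0)"
    using a_pos point_of_eq_0_iff[OF k(1)] point_of_eq_0_iff[OF k(2)]
    by (simp add: Ball_def del: point_nth) (metis less_not_refl)
  finally show ?thesis
    using numeratorsD(1)[OF k(1)] numeratorsD(1)[OF k(2)] by (simp add: list_all2_conv_all_nth)
qed

lemma roan_pairs_eq:
  assumes L: "set L \<subseteq> numerators" "{g \<in> H. level_one g} = point_of ` set L"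
    and M: "set M \<subseteq> numerators" "{g \<in> K. level_one g} = point_of ` set M"
  shows "roan_pairs a H K = map_prod point_of point_of ` set (pair_numerators L M)"
proof -
  have "set (zeros_numerators 2 L) \<subseteq> numerators" "set (zeros_numerators 3 M) \<subseteq> numerators"
    using L M by (auto simp: zeros_numerators_def)
  then have "roan_pairs a H K = map_prod point_of point_of `
      {(y, z). y \<in> set (zeros_numerators 2 L) \<and> z \<in> set (zeros_numerators 3 M)
        \<and> list_all2 (\<lambda>u v. u = 0 \<or> v = 0) y z}"
    unfolding roan_pairs_def level_one_zeros_eq[OF L] level_one_zeros_eq[OF M]
    using pairing_eq_0_iff by (fastforce simp del: point_nth)
  moreover have "{(y, z). y \<in> set (zeros_numerators 2 L) \<and> z \<in> set (zeros_numerators 3 M)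
        \<and> list_all2 (\<lambda>u v. u = 0 \<or> v = 0) y z} = set (pair_numerators L M)"
    by (auto simp: pair_numerators_def)
  ultimately show ?thesis
    by simp
qed

lemma hodge_count_eq:
  assumes L: "set L \<subseteq> numerators" "{g \<in> H. level_one g} = point_of ` set L"
    and M: "set M \<subseteq> numerators" "{g \<in> K. level_one g} = point_of ` set M"
  shows "card (deformations a H) + card (roan_pairs a H K) = hodge_count a L M"
proof -
  have "inj_on (map int) (set (deformation_numerators a L))"
    by (simp add: inj_on_def)
  moreover have "set (pair_numerators L M) \<subseteq> numerators \<times> numerators"
    using L(1) M(1) by (auto simp: pair_numerators_def zeros_numerators_def)
  then have "inj_on (map_prod point_of point_of) (set (pair_numerators L M))"
    using map_prod_inj_on[OF inj_on_point_of inj_on_point_of] inj_on_subset by blast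
  ultimately show ?thesis
    unfolding hodge_count_def deformations_eq[OF L] roan_pairs_eq[OF assms]
    by (simp add: card_image)
qed

end

section \<open>The extended group and its mirror dual\<close>

locale fermat_involution = fermat_exponents +
  fixes h :: "nat list"
  assumes a_gt_1: "\<And>i. i < 5 \<Longrightarrow> 1 < a ! i"
    and sum_w: "sum_list w = d"
    and h_numerators: "h \<in> numerators"
    and h_double: "\<And>i. i < 5 \<Longrightarrow> a ! i dvd 2 * h ! i"
    and h_weight: "d dvd weighted_sum w h"
    and h_not_diagonal: "h \<notin> set (diagonal_numerators a d)"
begin

sublocale Gmax: comm_group "Gmax a"
  by (rule comm_group_Gmax)

definition extension :: "rat list set" where
  "extension = G0 a \<union> (G0 a #>\<^bsub>Gmax a\<^esub> point_of h)"

text \<open>Here \<open>a_gt_1\<close> matters: for a_i = 1 the entry 1 would differ from its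
  fractional part 0.\<close>

lemma map_eq_point: "map (\<lambda>n. 1 / of_nat n) a = point (\<lambda>i. 1)"
proof (rule nth_equalityI)
  fix i
  assume "i < length (map (\<lambda>n. 1 / of_nat n :: rat) a)"
  then show "map (\<lambda>n. 1 / of_nat n) a ! i = point (\<lambda>i. 1) ! i"
    using a_gt_1[of i] by (simp add: length_a frac_eq)
qed (simp add: length_a)

lemma weight_const: "weight (\<lambda>i. j) = j * int d"
proof -
  have "(\<Sum>i<5. int (w ! i)) = int d"
    using sum_w length_w by (simp add: sum_list_sum_nth atLeast0LessThan flip: of_nat_sum)
  then show ?thesis
    by (simp add: weight_def flip: sum_distrib_left)
qed

lemma weight_h: "int d dvd weight (\<lambda>i. int (h ! i))"
  using h_weight weighted_sum_eq[OF numeratorsD(1)[OF h_numerators]] by (metis of_nat_dvd_iff)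

lemma point_const_mod: "point (\<lambda>i. j mod int d + f i) = point (\<lambda>i. j + f i)"
proof (rule point_eqI)
  fix i :: nat
  assume "i < 5"
  then have "int (a ! i) dvd int d"
    by (metis a_w dvd_triv_left of_nat_dvd_iff)
  moreover have "j mod int d + f i - (j + f i) = - (int d * (j div int d))"
    by (simp add: minus_div_mult_eq_mod[symmetric])
  ultimately show "int (a ! i) dvd j mod int d + f i - (j + f i)"
    by simp
qed

text \<open>Every a_i divides d, so j counts only modulo d. The case f = 0 lists G0 and the case f =
  h its other coset.\<close>

lemma range_point_const: "range (\<lambda>j. point (\<lambda>i. j + f i)) = (\<lambda>j. point (\<lambda>i. int j + f i)) ` {..<d}"
proof -
  have "point (\<lambda>i. j + f i) \<in> (\<lambda>j. point (\<lambda>i. int j + f i)) ` {..<d}" for j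
    using point_const_mod[of j f] d_pos
    by (intro image_eqI[where x = "nat (j mod int d)"]) (simp_all add: nat_less_iff)
  then show ?thesis
    by blast
qed

lemma subgroup_range: "subgroup (range (\<lambda>j. point (\<lambda>i. j))) (Gmax a)"
proof (rule Gmax.subgroupI)
  show "range (\<lambda>j. point (\<lambda>i. j)) \<subseteq> carrier (Gmax a)"
    by (auto simp: carrier_Gmax weight_const)
qed (auto simp: point_mult inv_point weight_const)

lemma G0_eq: "G0 a = range (\<lambda>j. point (\<lambda>i. j))"
proof
  show "G0 a \<subseteq> range (\<lambda>j. point (\<lambda>i. j))"
    unfolding G0_def
    by (rule Gmax.generate_subgroup_incl[OF _ subgroup_range]) (auto simp: map_eq_point)
  \<comment> \<open>Nonnegative multiples are enough: by periodicity modulo d, every negative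
    multiple equals one of them.\<close>
  have nat: "point (\<lambda>i. int j) \<in> G0 a" for j :: nat
  proof (induction j)
    case 0
    then show ?case
      using generate.one[of "Gmax a"] by (simp add: G0_def one_Gmax)
  next
    case (Suc j)
    have "point (\<lambda>i. 1) \<in> G0 a"
      by (simp add: G0_def map_eq_point generate.incl)
    then have "point (\<lambda>i. 1) \<otimes>\<^bsub>Gmax a\<^esub> point (\<lambda>i. int j) \<in> G0 a"
      using Suc unfolding G0_def by (rule generate.eng)
    then show ?case
      by (simp add: point_mult)
  qed
  show "range (\<lambda>j. point (\<lambda>i. j)) \<subseteq> G0 a"
    using range_point_const[of "\<lambda>i. 0"] nat by auto
qed

lemma extension_eq:
  "extension = range (\<lambda>j. point (\<lambda>i. j)) \<union> range (\<lambda>j. point (\<lambda>i. j + int (h ! i)))"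
  by (auto simp: extension_def G0_eq r_coset_def point_mult)

lemma diagonal_numerators_image:
  "set (diagonal_numerators a d) \<subseteq> numerators"
  "point_of ` set (diagonal_numerators a d) = G0 a"
proof -
  have mem: "map (\<lambda>n. j mod n) a \<in> numerators" for j
    using a_pos length_a by (auto simp: numerators_def list_all2_conv_all_nth)
  then show "set (diagonal_numerators a d) \<subseteq> numerators"
    by (auto simp: diagonal_numerators_def)
  have "point_of (map (\<lambda>n. j mod n) a) = point (\<lambda>i. int j)" for j
    by (rule point_eqI) (auto simp: length_a zmod_int mod_eq_dvd_iff[symmetric])
  then show "point_of ` set (diagonal_numerators a d) = G0 a"
    using range_point_const[of "\<lambda>i. 0"]
    by (simp add: diagonal_numerators_def G0_eq image_image atLeast0LessThan)
qed

lemma shifted_numerators_image: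
  "set (shifted_numerators a h d) \<subseteq> numerators"
  "point_of ` set (shifted_numerators a h d) = range (\<lambda>j. point (\<lambda>i. j + int (h ! i)))"
proof -
  note len = length_a numeratorsD(1)[OF h_numerators]
  have mem: "map2 (\<lambda>n x. (j + x) mod n) a h \<in> numerators" for j
    using a_pos len by (auto simp: numerators_def list_all2_conv_all_nth)
  then show "set (shifted_numerators a h d) \<subseteq> numerators"
    by (auto simp: shifted_numerators_def)
  have "point_of (map2 (\<lambda>n x. (j + x) mod n) a h) = point (\<lambda>i. int j + int (h ! i))" for j
    by (rule point_eqI) (auto simp: len zmod_int mod_eq_dvd_iff[symmetric])
  then show "point_of ` set (shifted_numerators a h d) = range (\<lambda>j. point (\<lambda>i. j + int (h ! i)))"
    unfolding range_point_const by (simp add: shifted_numerators_def image_image atLeast0LessThan)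
qed

lemma level_one_extension:
  "set (level_one_extension a w h d) \<subseteq> numerators"
  "{g \<in> extension. level_one g} = point_of ` set (level_one_extension a w h d)"
proof -
  let ?N = "set (diagonal_numerators a d @ shifted_numerators a h d)"
  have N: "?N \<subseteq> numerators"
    using diagonal_numerators_image(1) shifted_numerators_image(1) by simp
  then show "set (level_one_extension a w h d) \<subseteq> numerators"
    by (auto simp: level_one_extension_def)
  have "extension = point_of ` ?N"
    using diagonal_numerators_image(2) shifted_numerators_image(2)
    by (simp add: extension_eq G0_eq image_Un)
  then have "{g \<in> extension. level_one g} = point_of ` {k \<in> ?N. level_one (point_of k)}"
    by auto
  also have "{k \<in> ?N. level_one (point_of k)} = set (level_one_extension a w h d)"
    using N level_one_point_of by (auto simp: level_one_extension_def)
  finally show "{g \<in> extension. level_one g} = point_of ` set (level_one_extension a w h d)" .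
qed

text \<open>
  Pairing with the generator \<open>(1/a\<^sub>i)\<close> of \<open>G0 a\<close> is integral on all of \<open>Gmax a\<close>, so only
  the condition imposed by the involution remains.
\<close>

lemma point_mem_mirror_dual_iff:
  "point f \<in> mirror_dual a extension
    \<longleftrightarrow> int d dvd weight f \<and> int d dvd weight (\<lambda>i. int (h ! i) * f i)" (is "?l \<longleftrightarrow> ?r")
proof
  assume l: ?l
  have "point (\<lambda>i. int (h ! i)) \<in> extension"
    unfolding extension_eq using rangeI[of "\<lambda>j. point (\<lambda>i. j + int (h ! i))" 0] by simp
  then have "int d dvd weight (\<lambda>i. int (h ! i) * f i)"
    using l pairing_Ints[of "\<lambda>i. int (h ! i)" f] unfolding mirror_dual_def by blast
  moreover have "int d dvd weight f"
    using l sum_point_Ints[of f] by (auto simp: mirror_dual_def Gmax_def)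
  ultimately show ?r
    by blast
next
  assume r: ?r
  have "int d dvd weight (\<lambda>i. j * f i)" "int d dvd weight (\<lambda>i. (j + int (h ! i)) * f i)" for j
    using r by (simp_all add: weight_mult weight_add distrib_right)
  then have "(\<Sum>i<5. g ! i * of_nat (a ! i) * point f ! i) \<in> \<int>" if "g \<in> extension" for g
    using that pairing_Ints unfolding extension_eq by blast
  then show ?l
    using r by (auto simp: mirror_dual_def carrier_Gmax)
qed

lemma level_one_dual:
  "set (level_one_dual a w h d) \<subseteq> numerators"
  "{g \<in> mirror_dual a extension. level_one g} = point_of ` set (level_one_dual a w h d)"
proof -
  have set_eq: "set (level_one_dual a w h d)
      = {k \<in> numerators. weighted_sum w k = d \<and> d dvd weighted_sum w (map2 (*) h k)}"
    by (auto simp: level_one_dual_def set_solutions length_a length_w numerators_def)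
  then show "set (level_one_dual a w h d) \<subseteq> numerators"
    by blast
  have mem: "point_of k \<in> mirror_dual a extension \<and> level_one (point_of k)
      \<longleftrightarrow> weighted_sum w k = d \<and> d dvd weighted_sum w (map2 (*) h k)" if k: "k \<in> numerators" for k
  proof -
    note len = numeratorsD(1)[OF h_numerators] numeratorsD(1)[OF k]
    have "int (weighted_sum w (map2 (*) h k)) = weight (\<lambda>i. int (map2 (*) h k ! i))"
      using len by (intro weighted_sum_eq) simp
    also have "\<dots> = weight (\<lambda>i. int (h ! i) * int (k ! i))"
      unfolding weight_def using len by (intro sum.cong) auto
    finally have "d dvd weighted_sum w (map2 (*) h k)
        \<longleftrightarrow> int d dvd weight (\<lambda>i. int (h ! i) * int (k ! i))"
      by (metis of_nat_dvd_iff)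
    then show ?thesis
      unfolding point_mem_mirror_dual_iff level_one_point_of[OF k] weighted_sum_eq[OF len(2), symmetric]
      by auto
  qed
  \<comment> \<open>Every element of the dual has reduced numerators, so the search misses
    none.\<close>
  have "\<exists>k\<in>numerators. g = point_of k" if "g \<in> mirror_dual a extension" for g
    using that point_reduce by (auto simp: mirror_dual_def elim!: carrier_GmaxE) metis
  then show "{g \<in> mirror_dual a extension. level_one g} = point_of ` set (level_one_dual a w h d)"
    unfolding set_eq using mem by blast
qed

lemma roan_h11_extension:
  "roan_h11 a extension = hodge_count a (level_one_extension a w h d) (level_one_dual a w h d)"
  unfolding roan_h11_def by (rule hodge_count_eq[OF level_one_extension level_one_dual])

lemma roan_h21_extension:
  "roan_h21 a extension = hodge_count a (level_one_dual a w h d) (level_one_extension a w h d)"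
  unfolding roan_h21_def by (rule hodge_count_eq[OF level_one_dual level_one_extension])

lemma subgroup_G0: "subgroup (G0 a) (Gmax a)"
  using subgroup_range by (simp add: G0_eq)

lemma point_of_h:
  "point_of h \<in> carrier (Gmax a)"
  "point_of h \<otimes>\<^bsub>Gmax a\<^esub> point_of h = \<one>\<^bsub>Gmax a\<^esub>"
  "point_of h \<notin> G0 a"
proof -
  show "point_of h \<in> carrier (Gmax a)"
    using weight_h by (auto simp: carrier_Gmax)
  show "point_of h \<otimes>\<^bsub>Gmax a\<^esub> point_of h = \<one>\<^bsub>Gmax a\<^esub>"
    unfolding point_mult one_Gmax
    by (rule point_eqI) (use h_double in \<open>simp add: mult_2 flip: of_nat_add\<close>)
  show "point_of h \<notin> G0 a"
    using h_not_diagonal inj_on_image_mem_iff[OF inj_on_point_of h_numerators]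
      diagonal_numerators_image by metis
qed

lemma subgroup_extension: "subgroup extension (Gmax a)"
  unfolding extension_def
  by (intro Gmax.subgroup_Un_involution_coset subgroup_G0 point_of_h)

lemma extension_iso:
  "(Gmax a)\<lparr>carrier := extension\<rparr> \<cong> (Gmax a)\<lparr>carrier := G0 a\<rparr> \<times>\<times> integer_mod_group 2"
  unfolding extension_def
  by (intro Gmax.subgroup_Un_involution_coset_iso subgroup_G0 point_of_h)

end

section \<open>Numerical certificates for the ten exponent tuples\<close>

lemma hodge_check_imp:
  assumes "hodge_check a w h d p q"
  shows "\<exists>G. G0 a \<subseteq> G \<and> subgroup G (Gmax a)
    \<and> (Gmax a)\<lparr>carrier := G\<rparr> \<cong> (Gmax a)\<lparr>carrier := G0 a\<rparr> \<times>\<times> integer_mod_group 2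
    \<and> roan_h11 a G = p \<and> roan_h21 a G = q"
proof -
  have inv: "involution_numerators a w h d"
    using assms by (simp add: hodge_check_def)
  interpret fermat_exponents a w d
    by unfold_locales
      (use inv in \<open>auto simp: involution_numerators_def list_all2_conv_all_nth\<close>)
  interpret fermat_involution a w d h
    by unfold_locales
      (use inv in \<open>auto simp: involution_numerators_def numerators_def list_all2_conv_all_nth list_all_length\<close>)
  have "roan_h11 a extension = p" "roan_h21 a extension = q"
    using assms by (simp_all add: hodge_check_def Let_def roan_h11_extension roan_h21_extension)
  moreover have "G0 a \<subseteq> extension"
    by (simp add: extension_def)
  ultimately show ?thesis
    using subgroup_extension extension_iso by blast
qed

text \<open>Each d is the lcm of the exponents, and the last two numbers are 5 + 3r - 2a and 65 - 3r
  - 2a. A nonzero entry of h is half its exponent, and determinant 1 forces an even number of them.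
  G0 is cyclic of even order d; its single involution has coordinate 1/2 exactly where a_i contains
  the full power of two in d, and h is chosen different from it. That this h gives the right Hodge
  numbers is settled by evaluation.\<close>

lemma hodge_checks:
  shows
    "hodge_check [4, 4, 6, 6, 6] [3, 3, 2, 2, 2] [2, 0, 3, 3, 3] 12 6 60"
    and "hodge_check [4, 4, 4, 8, 8] [2, 2, 2, 1, 1] [2, 2, 0, 0, 0] 8 7 55"
    and "hodge_check [3, 4, 4, 7, 42] [28, 21, 21, 12, 2] [0, 2, 0, 0, 21] 84 35 35"
    and "hodge_check [3, 4, 4, 10, 15] [20, 15, 15, 6, 4] [0, 2, 0, 5, 0] 60 27 27"
    and "hodge_check [4, 4, 4, 5, 20] [5, 5, 5, 4, 1] [2, 2, 0, 0, 0] 20 15 39"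
    and "hodge_check [4, 4, 4, 6, 12] [3, 3, 3, 2, 1] [2, 2, 0, 0, 0] 12 9 45"
    and "hodge_check [3, 4, 4, 8, 24] [8, 6, 6, 3, 1] [0, 2, 2, 0, 0] 24 19 43"
    and "hodge_check [3, 4, 4, 12, 12] [4, 3, 3, 1, 1] [0, 2, 2, 0, 0] 12 11 59"
    and "hodge_check [4, 4, 5, 5, 10] [5, 5, 4, 4, 2] [2, 0, 0, 0, 5] 20 15 39"
    and "hodge_check [3, 4, 4, 9, 18] [12, 9, 9, 4, 2] [0, 2, 0, 0, 9] 36 19 43"
  by code_simp+

theorem theorem7p3:
  fixes a :: "nat list" and r s :: nat
  assumes "(a, r, s) \<in>
    {([4, 4, 6, 6, 6], 1, 1),
     ([4, 4, 4, 8, 8], 2, 2),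
     ([3, 4, 4, 7, 42], 10, 0),
     ([3, 4, 4, 10, 15], 10, 4),
     ([4, 4, 4, 5, 20], 6, 4),
     ([4, 4, 4, 6, 12], 4, 4),
     ([3, 4, 4, 8, 24], 6, 2),
     ([3, 4, 4, 12, 12], 2, 0),
     ([4, 4, 5, 5, 10], 6, 4),
     ([3, 4, 4, 9, 18], 6, 2)}"
  shows "\<exists>G. G0 a \<subseteq> G \<and> subgroup G (Gmax a)
    \<and> (Gmax a)\<lparr>carrier := G\<rparr> \<cong> (Gmax a)\<lparr>carrier := G0 a\<rparr> \<times>\<times> integer_mod_group 2
    \<and> int (roan_h11 a G) = 5 + 3 * int r - 2 * int s
    \<and> int (roan_h21 a G) = 65 - 3 * int r - 2 * int s"
proof -
  \<comment> \<open>Here \<open>s\<close> is the Nikulin invariant a, and the differences are taken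
    in the integers to avoid truncation.\<close>
  have "\<exists>w h d p q. hodge_check a w h d p q
      \<and> int p = 5 + 3 * int r - 2 * int s \<and> int q = 65 - 3 * int r - 2 * int s"
    using assms by (auto; use hodge_checks in fastforce)
  then show ?thesis
    using hodge_check_imp by metis
qed

end
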